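(* Let $\alpha\in[0,1)$ and $f\in CC_\alpha$. Then $$\operatorname{Re}\left\{\frac{f(z)}{z}\right\}\ge m(|z|),\qquad z\in\mathbb{D},$$ where $m(t)=\max\left\{\left(\tfrac12\right)^{1-\alpha},\,p(t)\right\}$ and $$p(t)=\frac12\left[1+\frac{1-(1-\alpha)^2t^2}{(1+t)^{2(1-\alpha)}}\right].$$
   Context: $\mathbb{D}=\{z\in\mathbb{C}:|z|<1\}$. For $\alpha\in[0,1)$, the class $CC_\alpha$ (completely convex mappings of order $\alpha$) consists of the analytic functions $f(z)=z+a_2z^2+\cdots$ on $\mathbb{D}$ satisfying $$\operatorname{Re}\left\{\frac{2zf'(z)}{f(z)-f(x)}-\frac{z+x}{z-x}\right\}\ge\alpha,\qquad z,x\in\mathbb{D},$$ where it is understood that $f(z)\neq f(x)$ for $z\ne x$, and that for $z=x$ the expression in braces is given its limiting value $1+zf''(z)/f'(z)$. At $z=0$, $f(z)/z$ is understood as its limit $1$. *)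

theory Defs
  imports "HOL-Complex_Analysis.Complex_Analysis"
begin

(* The value at z = x is the limit of the general expression as x tends to z
   (for deriv f z \<noteq> 0, which holds for injective holomorphic f). *)
definition cc_expr :: "(complex \<Rightarrow> complex) \<Rightarrow> complex \<Rightarrow> complex \<Rightarrow> complex" where
  "cc_expr f z x =
     (if z = x then 1 + z * deriv (deriv f) z / deriv f z
      else 2 * z * deriv f z / (f z - f x) - (z + x) / (z - x))"

(* Completely convex mappings of order \<alpha>, normalised by f(z) = z + a_2 z^2 + ... .
   Injectivity is the proviso f(z) \<noteq> f(x) for z \<noteq> x. *)
definition CC :: "real \<Rightarrow> (complex \<Rightarrow> complex) set" where
  "CC \<alpha> = {f. f holomorphic_on ball 0 1 \<and> f 0 = 0 \<and> deriv f 0 = 1 \<and>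
              inj_on f (ball 0 1) \<and>
              (\<forall>z\<in>ball 0 1. \<forall>x\<in>ball 0 1. Re (cc_expr f z x) \<ge> \<alpha>)}"

definition quot_id :: "(complex \<Rightarrow> complex) \<Rightarrow> complex \<Rightarrow> complex" where
  "quot_id f z = (if z = 0 then 1 else f z / z)"

definition p_bound :: "real \<Rightarrow> real \<Rightarrow> real" where
  "p_bound \<alpha> t =
     1 / 2 * (1 + (1 - (1 - \<alpha>)\<^sup>2 * t\<^sup>2) / (1 + t) powr (2 * (1 - \<alpha>)))"

definition m_bound :: "real \<Rightarrow> real \<Rightarrow> real" where
  "m_bound \<alpha> t = max ((1 / 2) powr (1 - \<alpha>)) (p_bound \<alpha> t)"

end

theory Submission
  imports Defs
begin

text \<open>Fix \<open>x\<close> and let \<open>G z = (f z - f x) / (z - x)\<close>. Off the diagonal the defining expression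
is \<open>1 + 2 * z * G' z / G z\<close>, so after subtracting \<open>\<alpha>\<close> and dividing by \<open>\<beta> = 1 - \<alpha>\<close> it is a
Caratheodory function of \<open>z\<close>. The bound on its first coefficient, \<open>2 / \<beta> * (1 / x - 1 / f x)\<close>, gives
\<open>\<bar>1 - x / f x\<bar> \<le> \<beta> * \<bar>x\<bar>\<close>.
For \<open>x = 0\<close> write \<open>f z / z = exp (\<beta> * L z)\<close>; Jack's lemma yields \<open>\<bar>1 - exp (- L z)\<bar> \<le> \<bar>z\<bar>\<close>, hence
\<open>\<bar>f z / z\<bar> \<ge> (1 + \<bar>z\<bar>) powr - \<beta>\<close>, and, \<open>\<lambda>x. ln (cos x)\<close> being concave,
\<open>Re (f z / z) \<ge> 2 powr - \<beta>\<close>. The bound \<open>p\<close> then follows from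
\<open>2 * Re u - 1 = \<bar>u\<bar>\<^sup>2 * (1 - \<bar>1 - 1 / u\<bar>\<^sup>2)\<close> with \<open>u = f z / z\<close>.\<close>

section \<open>Schwarz and Caratheodory bounds\<close>

text \<open>\<open>Schwarz_Lemma\<close> asks for a strict bound by 1, so it is applied to
  \<open>c * h\<close> with \<open>0 < c < 1\<close>; letting \<open>c\<close> tend to 1 gives both
  claims.\<close>

lemma Schwarz_lemma_le:
  fixes h :: "complex \<Rightarrow> complex"
  assumes h: "h holomorphic_on ball 0 1" and h0: "h 0 = 0"
    and le: "\<And>z. cmod z < 1 \<Longrightarrow> cmod (h z) \<le> 1"
  shows "cmod z < 1 \<Longrightarrow> cmod (h z) \<le> cmod z" and "cmod (deriv h 0) \<le> 1"
proof -
  have *: "cmod z < 1 \<longrightarrow> c * cmod (h z) \<le> cmod z" "c * cmod (deriv h 0) \<le> 1"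
    if c: "0 < c" "c < 1" for c :: real and z
  proof -
    have hol: "(\<lambda>z. of_real c * h z) holomorphic_on ball 0 1"
      by (intro holomorphic_intros h)
    have lt: "cmod (of_real c * h z) < 1" if "cmod z < 1" for z
    proof -
      have "c * cmod (h z) \<le> c * 1"
        using c le[OF that] by (intro mult_left_mono) auto
      with c have "c * cmod (h z) < 1" by linarith
      then show ?thesis using c by (simp add: norm_mult)
    qed
    have d: "deriv (\<lambda>z. of_real c * h z) 0 = of_real c * deriv h 0"
      using h by (intro deriv_cmult holomorphic_on_imp_differentiable_at[of h "ball 0 1"]) auto
    show "cmod z < 1 \<longrightarrow> c * cmod (h z) \<le> cmod z"
      using Schwarz_Lemma(1)[OF hol _ lt, of z] h0 c by (simp add: norm_mult)
    show "c * cmod (deriv h 0) \<le> 1"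
      using Schwarz_Lemma(2)[OF hol _ lt, of 0] h0 c by (simp add: norm_mult d)
  qed
  show "cmod z < 1 \<Longrightarrow> cmod (h z) \<le> cmod z"
    using *(1)[of _ z] by (blast intro: field_le_mult_one_interval)
  show "cmod (deriv h 0) \<le> 1"
    using *(2) by (blast intro: field_le_mult_one_interval)
qed

text \<open>The Cayley transform \<open>w\<close> of \<open>C\<close> sends 0 to 0 and the disc into
  the closed unit disc. A zero of \<open>Re (C z)\<close> would give \<open>cmod (w z) = 1\<close>,
  against Schwarz; and \<open>deriv w 0\<close> is half of \<open>deriv C 0\<close>.\<close>

lemma Caratheodory_bounds:
  fixes C :: "complex \<Rightarrow> complex"
  assumes C: "C holomorphic_on ball 0 1" and C0: "C 0 = 1"
    and Re: "\<And>z. cmod z < 1 \<Longrightarrow> Re (C z) \<ge> 0"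
  shows "cmod z < 1 \<Longrightarrow> Re (C z) > 0" and "cmod (deriv C 0) \<le> 2"
proof -
  define w where "w = (\<lambda>z. (C z - 1) / (C z + 1))"
  have nz: "C z + 1 \<noteq> 0" if "cmod z < 1" for z
    using Re[OF that] by (auto simp: complex_eq_iff)
  have hol: "w holomorphic_on ball 0 1"
    unfolding w_def using nz by (intro holomorphic_intros C) auto
  have sq: "(cmod (C z - 1))\<^sup>2 = (cmod (C z + 1))\<^sup>2 - 4 * Re (C z)" for z
    unfolding cmod_power2 by (simp add: power2_eq_square algebra_simps)
  have le: "cmod (w z) \<le> 1" if "cmod z < 1" for z
  proof -
    have "(cmod (C z - 1))\<^sup>2 \<le> (cmod (C z + 1))\<^sup>2"
      using sq[of z] Re[OF that] by linarith
    then have "cmod (C z - 1) \<le> cmod (C z + 1)" by (rule power2_le_imp_le) simp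
    then show ?thesis using nz[OF that] by (simp add: w_def norm_divide)
  qed
  have w0: "w 0 = 0" by (simp add: w_def C0)
  show "Re (C z) > 0" if z: "cmod z < 1"
  proof (rule ccontr)
    assume "\<not> Re (C z) > 0"
    with Re[OF z] have "Re (C z) = 0" by simp
    with sq[of z] have "(cmod (C z - 1))\<^sup>2 = (cmod (C z + 1))\<^sup>2" by linarith
    then have "cmod (C z - 1) = cmod (C z + 1)"
      using power2_eq_iff_nonneg norm_ge_zero by blast
    then have "cmod (w z) = 1" using nz[OF z] by (simp add: w_def norm_divide)
    then show False using Schwarz_lemma_le(1)[OF hol w0 le z] z by simp
  qed
  have "(C has_field_derivative deriv C 0) (at 0)"
    using C by (intro holomorphic_derivI[of C "ball 0 1"]) auto
  then have "(w has_field_derivative deriv C 0 / 2) (at 0)"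
    unfolding w_def by (auto intro!: derivative_eq_intros simp: C0)
  then have "deriv w 0 = deriv C 0 / 2" by (rule DERIV_imp_deriv)
  then have "cmod (deriv w 0) = cmod (deriv C 0) / 2" by (simp only: norm_divide norm_numeral)
  then show "cmod (deriv C 0) \<le> 2"
    using Schwarz_lemma_le(2)[OF hol w0 le] by simp
qed

section \<open>Jack's lemma and its consequence for logarithms\<close>

text \<open>Multiplication by \<open>c\<close> keeps the left half-plane in its closure, so it
  cannot rotate. In Jack's lemma this shows that \<open>D - 1\<close> is real and
  nonnegative.\<close>

lemma nonneg_real_if_Re_mult_le_0:
  fixes c :: complex
  assumes "\<And>v. Re v < 0 \<Longrightarrow> Re (c * v) \<le> 0"
  shows "Im c = 0" and "Re c \<ge> 0"
proof -
  have Re: "- e * Re c - d * Im c \<le> 0" if "e > 0" for e d :: real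
    using assms[of "Complex (- e) d"] that by (simp add: algebra_simps)
  show "Re c \<ge> 0" using Re[of 1 0] by simp
  show "Im c = 0"
  proof (rule ccontr)
    assume *: "Im c \<noteq> 0"
    \<comment> \<open>This choice of \<open>d\<close> makes the left side of \<open>Re\<close> equal
      to 1.\<close>
    show False using Re[of 1 "- (Re c + 1) / Im c"] * by simp
  qed
qed

text \<open>The point sought is a \<open>z0\<close> of least modulus with
  \<open>cmod (h z0) \<ge> 1\<close>. Schwarz on the disc of radius \<open>cmod z0\<close> says that
  the modulus of \<open>h\<close> decays at least linearly from \<open>z0\<close> towards the
  centre, which forces \<open>k \<ge> 1\<close>; that it does not exceed 1 on nearby points of the
  circle makes \<open>k\<close> real.\<close>

lemma Jack_lemma:
  fixes h :: "complex \<Rightarrow> complex"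
  assumes h: "h holomorphic_on ball 0 1" and h0: "h 0 = 0"
    and z1: "cmod z1 < 1" "cmod (h z1) \<ge> 1"
  obtains z k where "cmod z < 1" "cmod (h z) = 1" "1 \<le> k" "z * deriv h z = of_real k * h z"
proof -
  define K where "K = cball 0 (cmod z1) \<inter> (\<lambda>z. cmod (h z)) -` {1..}"
  have cont: "continuous_on (ball 0 1) h" by (rule holomorphic_on_imp_continuous_on[OF h])
  have "closed K" unfolding K_def
    using z1(1) by (intro continuous_closed_preimage continuous_intros continuous_on_subset[OF cont]) auto
  then have "compact K"
    by (auto simp: compact_eq_bounded_closed K_def intro: bounded_subset[OF bounded_cball])
  moreover have "z1 \<in> K" using z1 by (simp add: K_def)
  ultimately obtain z0 where z0: "z0 \<in> K" and min: "\<And>z. z \<in> K \<Longrightarrow> cmod z0 \<le> cmod z"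
    using continuous_attains_inf[of K cmod] by (auto intro: continuous_intros)
  have lt: "cmod (h z) < 1" if "cmod z < cmod z0" for z
    using min[of z] that z0 by (fastforce simp: K_def)
  have z01: "cmod z0 < 1" and ge: "cmod (h z0) \<ge> 1" using z0 z1 by (auto simp: K_def)
  have nz: "z0 \<noteq> 0" using ge h0 by auto
  have hz0: "h z0 \<noteq> 0" using ge by auto
  have Sch: "cmod (h (z0 * w)) \<le> cmod w" if "cmod w < 1" for w
  proof (rule Schwarz_lemma_le(1)[of "\<lambda>w. h (z0 * w)"])
    have "cmod (z0 * w) < 1" if "cmod w < 1" for w
      using mult_strict_mono'[OF z01 that] by (simp add: norm_mult)
    then show "(\<lambda>w. h (z0 * w)) holomorphic_on ball 0 1"
      by (intro holomorphic_on_compose_gen[OF _ h, unfolded o_def] holomorphic_intros) auto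
    show "cmod (h (z0 * w)) \<le> 1" if "cmod w < 1" for w
      using lt[of "z0 * w"] that nz by (simp add: norm_mult)
  qed (use h0 that in auto)
  have dh: "(h has_field_derivative deriv h z0) (at z0)"
    using z01 by (intro holomorphic_derivI[OF h]) auto
  \<comment> \<open>The upper bound is the limit of \<open>Sch\<close> along the radius, as
    \<open>w\<close> tends to 1 from the left.\<close>
  have one: "cmod (h z0) = 1"
  proof (rule antisym)
    have "((\<lambda>t. cmod (h (z0 * of_real t))) \<longlongrightarrow> cmod (h (z0 * of_real 1))) (at_left 1)"
    proof (intro tendsto_norm isCont_tendsto_compose[of _ h] tendsto_intros)
      show "isCont h (z0 * of_real 1)" using DERIV_isCont[OF dh] by simp
    qed
    moreover have "eventually (\<lambda>t::real. cmod (h (z0 * of_real t)) \<le> 1) (at_left 1)"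
      using eventually_at_left_real[of 0 1]
    proof (rule eventually_mono)
      show "cmod (h (z0 * of_real t)) \<le> 1" if "t \<in> {0<..<1}" for t :: real
        using Sch[of "of_real t"] that by auto
    qed simp
    ultimately show "cmod (h z0) \<le> 1"
      using tendsto_upperbound[OF _ _ trivial_limit_at_left_real] by fastforce
  qed (rule ge)
  define D where "D = z0 * deriv h z0 / h z0"
  \<comment> \<open>\<open>h (z0 * exp s) * exp (- s) / h z0\<close> is bounded by 1 for \<open>Re s < 0\<close>, with value 1 and
      derivative \<open>D - 1\<close> at 0.\<close>
  have Re_le: "Re ((D - 1) * v) \<le> 0" if v: "Re v < 0" for v
  proof (rule ccontr)
    define g where "g = (\<lambda>t::real. Re (h (z0 * exp (of_real t * v)) * exp (- (of_real t * v)) / h z0))"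
    define G where "G = (\<lambda>s::complex. h (z0 * exp (s * v)) * exp (- (s * v)) / h z0)"
    assume "\<not> Re ((D - 1) * v) \<le> 0"
    then have pos: "Re ((D - 1) * v) > 0" by simp
    have "(G has_field_derivative (D - 1) * v) (at 0)"
      unfolding G_def D_def using hz0
      by (auto intro!: derivative_eq_intros DERIV_chain2[of h "deriv h z0"] dh simp: field_simps)
    then have "((\<lambda>t::real. G (of_real t)) has_vector_derivative (D - 1) * v) (at 0)"
      using has_vector_derivative_real_field[of G "(D - 1) * v" 0 UNIV] by simp
    then have "(g has_real_derivative Re ((D - 1) * v)) (at 0)"
      using has_field_derivative_Re unfolding g_def G_def
      by blast
    from DERIV_pos_inc_right[OF this pos] obtain d where d: "d > 0"
      "\<And>t. t > 0 \<Longrightarrow> t < d \<Longrightarrow> g 0 < g (0 + t)" by auto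
    have g0: "g 0 = 1" using hz0 by (simp add: g_def)
    define t where "t = d / 2"
    have t: "t > 0" "t < d" using d by (auto simp: t_def)
    have tv: "t * Re v < 0" using t v by (simp add: mult_pos_neg)
    have "cmod (h (z0 * exp (of_real t * v))) \<le> exp (t * Re v)"
      using Sch[of "exp (of_real t * v)"] tv by simp
    then have "cmod (h (z0 * exp (of_real t * v)) * exp (- (of_real t * v)) / h z0) \<le> 1"
      using one by (simp add: norm_mult norm_divide exp_minus field_simps)
    then have "g t \<le> 1"
      unfolding g_def using complex_Re_le_cmod order_trans by blast
    then show False using d(2)[OF t] g0 by simp
  qed
  have "D = of_real (Re D)" and "Re D \<ge> 1"
    using nonneg_real_if_Re_mult_le_0[OF Re_le] by (auto simp: complex_eq_iff)
  moreover have "z0 * deriv h z0 = D * h z0" using hz0 by (simp add: D_def)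
  ultimately show ?thesis using that[OF z01 one] by metis
qed

text \<open>Put \<open>h = 1 - exp (- L)\<close>, so that \<open>h' = L' * (1 - h)\<close>. If
  \<open>h\<close> left the closed unit disc, Jack's lemma would give a point with
  \<open>z * L' = k * h / (1 - h)\<close> and \<open>cmod h = 1\<close>. There
  \<open>h / (1 - h)\<close> has real part \<open>- 1 / 2\<close>, so the real part of
  \<open>z * L'\<close> would be \<open>- k / 2\<close>, which is at most \<open>- 1 / 2\<close>.
  Schwarz then sharpens the bound 1 to \<open>cmod z\<close>.\<close>

lemma norm_one_minus_exp_le:
  fixes L :: "complex \<Rightarrow> complex"
  assumes L: "L holomorphic_on ball 0 1" and L0: "L 0 = 0"
    and Re: "\<And>z. cmod z < 1 \<Longrightarrow> Re (z * deriv L z) > - 1 / 2"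
    and z: "cmod z < 1"
  shows "cmod (1 - exp (- L z)) \<le> cmod z"
proof (rule Schwarz_lemma_le(1)[of "\<lambda>z. 1 - exp (- L z)"])
  define h where "h = (\<lambda>z. 1 - exp (- L z))"
  show hol: "(\<lambda>z. 1 - exp (- L z)) holomorphic_on ball 0 1"
    by (intro holomorphic_intros L)
  show "cmod (1 - exp (- L z1)) \<le> 1" if z1: "cmod z1 < 1" for z1
  proof (rule ccontr)
    assume "\<not> cmod (1 - exp (- L z1)) \<le> 1"
    then have "1 \<le> cmod (h z1)" by (simp add: h_def)
    moreover have "h 0 = 0" using L0 by (simp add: h_def)
    ultimately obtain z k where z: "cmod z < 1" "cmod (h z) = 1" "1 \<le> k"
      "z * deriv h z = of_real k * h z"
      using Jack_lemma[of h z1] hol[folded h_def] z1 by metis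
    have "(L has_field_derivative deriv L z) (at z)"
      using z by (intro holomorphic_derivI[OF L]) auto
    then have "(h has_field_derivative deriv L z * exp (- L z)) (at z)"
      unfolding h_def by (auto intro!: derivative_eq_intros)
    then have "deriv h z = deriv L z * (1 - h z)"
      by (simp add: h_def DERIV_imp_deriv)
    with z(4) have eq: "(z * deriv L z) * (1 - h z) = of_real k * h z" by (simp add: mult.assoc)
    have nz: "1 - h z \<noteq> 0" by (simp add: h_def)
    have "Re (h z / (1 - h z)) = - 1 / 2"
    proof -
      have a: "(Re (h z))\<^sup>2 + (Im (h z))\<^sup>2 = 1"
        using z(2) by (metis cmod_power2 one_power2)
      have "(1 - Re (h z))\<^sup>2 + (Im (h z))\<^sup>2 \<noteq> 0"
        using nz by (auto simp: complex_eq_iff sum_power2_eq_zero_iff)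
      then show ?thesis using a by (simp add: Re_divide field_simps) (simp add: power2_eq_square algebra_simps)
    qed
    moreover have "z * deriv L z = of_real k * (h z / (1 - h z))"
      unfolding times_divide_eq_right eq[symmetric] using nz by simp
    ultimately have "Re (z * deriv L z) = - k / 2"
      by (simp only: times_complex.sel Re_complex_of_real Im_complex_of_real)
    then show False using Re[OF z(1)] z(3) by simp
  qed
qed (use z L0 in auto)

section \<open>A lower bound for the real part of a power\<close>

text \<open>The function \<open>- ln (cos x)\<close> has derivative \<open>tan x\<close>, which is
  increasing, so it is convex; it vanishes at 0, and convexity is used between 0 and
  \<open>c\<close>.\<close>

lemma cos_powr_le:
  fixes b c :: real
  assumes "0 \<le> b" "b \<le> 1" "\<bar>c\<bar> < pi / 2"
  shows "cos c powr b \<le> cos (b * c)"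
proof -
  have cos: "cos x > 0" if "\<bar>x\<bar> < pi / 2" for x :: real
    using that by (intro cos_gt_zero_pi) auto
  have "convex_on {-pi/2<..<pi/2} (\<lambda>x. - ln (cos x))"
  proof (rule f''_ge0_imp_convex)
    fix x :: real assume "x \<in> {-pi/2<..<pi/2}"
    then have "cos x > 0" using cos[of x] by (auto simp: abs_less_iff)
    then show "((\<lambda>x. - ln (cos x)) has_real_derivative tan x) (at x)"
      and "(tan has_real_derivative inverse ((cos x)\<^sup>2)) (at x)"
      by (auto intro!: derivative_eq_intros simp: tan_def field_simps power2_eq_square)
  qed auto
  moreover have "c \<in> {-pi/2<..<pi/2}" using assms(3) by (auto simp: abs_less_iff)
  moreover have "0 \<in> {-pi/2<..<pi/2}" by simp
  ultimately have "- ln (cos ((1 - b) *\<^sub>R 0 + b *\<^sub>R c)) \<le> (1 - b) * (- ln (cos 0)) + b * (- ln (cos c))"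
    using assms(1,2) by (intro convex_onD)
  then have ln: "b * ln (cos c) \<le> ln (cos (b * c))" by simp
  have "\<bar>b * c\<bar> \<le> \<bar>c\<bar>" using assms mult_right_mono[of b 1 "\<bar>c\<bar>"] by (simp add: abs_mult)
  then have "cos (b * c) > 0" using assms cos by simp
  moreover have "cos c > 0" using assms cos by simp
  ultimately show ?thesis
    using ln by (simp add: powr_def) (metis exp_le_cancel_iff exp_ln)
qed

text \<open>For \<open>u = exp (L w)\<close> the hypothesis reads
  \<open>cmod (u - 1) < cmod u\<close>, that is, \<open>Re u > 1 / 2\<close>. It remains to compare
  the real part of the \<open>b\<close>-th power with the \<open>b\<close>-th power of the real
  part, which is \<open>cos_powr_le\<close> for the argument \<open>Im (L z)\<close>.\<close>

lemma Re_exp_mult_ge: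
  fixes L :: "complex \<Rightarrow> complex"
  assumes L: "continuous_on (ball 0 1) L" and L0: "L 0 = 0"
    and le: "\<And>z. cmod z < 1 \<Longrightarrow> cmod (1 - exp (- L z)) < 1"
    and z: "cmod z < 1" and b: "0 \<le> b" "b \<le> 1"
  shows "Re (exp (of_real b * L z)) \<ge> (1 / 2) powr b"
proof -
  have half: "1 / 2 < exp (Re (L w)) * cos (Im (L w))" if w: "cmod w < 1" for w
  proof -
    define u where "u = exp (L w)"
    have "cmod (u - 1) = cmod (u * (1 - exp (- L w)))" by (simp add: u_def exp_minus algebra_simps)
    also have "\<dots> < cmod u" using le[OF w] by (simp add: norm_mult u_def)
    finally have "(cmod (u - 1))\<^sup>2 < (cmod u)\<^sup>2" by (intro power_strict_mono) auto
    then have "1 / 2 < Re u"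
      unfolding cmod_power2 by (simp add: power2_eq_square algebra_simps)
    then show ?thesis by (simp add: u_def Re_exp)
  qed
  have cos_pos: "cos (Im (L w)) > 0" if "cmod w < 1" for w
    using half[OF that] by (smt (verit) mult_nonneg_nonpos exp_ge_zero half_gt_zero)
  \<comment> \<open>Positivity of the cosine fixes \<open>Im (L z)\<close> only modulo
    \<open>2 * pi\<close>. Since \<open>L 0 = 0\<close>, an imaginary part of size
    \<open>pi / 2\<close> or more would have to pass through \<open>pi / 2\<close> in absolute value
    on the segment from 0 to \<open>z\<close>, where the cosine would vanish.\<close>
  have Im_lt: "\<bar>Im (L z)\<bar> < pi / 2"
  proof (rule ccontr)
    assume *: "\<not> \<bar>Im (L z)\<bar> < pi / 2"
    have in_ball: "cmod (of_real t * z) < 1" if "t \<in> {0..1}" for t :: real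
      using that z mult_left_le_one_le[of "cmod z" t] by (auto simp: norm_mult)
    have "continuous_on {0..1} (\<lambda>t::real. L (of_real t * z))"
      using in_ball by (intro continuous_on_compose2[OF L] continuous_intros) auto
    then have "continuous_on {0..1} (\<lambda>t::real. \<bar>Im (L (of_real t * z))\<bar>)"
      by (intro continuous_intros)
    then obtain t :: real where t: "0 \<le> t" "t \<le> 1" "\<bar>Im (L (of_real t * z))\<bar> = pi / 2"
      using IVT'[of "\<lambda>t::real. \<bar>Im (L (of_real t * z))\<bar>" 0 "pi / 2" 1] * L0 by auto
    then have "cos (Im (L (of_real t * z))) = 0"
      by (metis cos_abs_real cos_pi_half)
    then show False using cos_pos[OF in_ball[of t]] t by simp
  qed
  define a where "a = Re (L z)"
  define c where "c = Im (L z)"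
  have c: "\<bar>c\<bar> < pi / 2" "cos c > 0" using Im_lt cos_pos[OF z] by (auto simp: c_def)
  have "(1 / 2) powr b \<le> (exp a * cos c) powr b"
    using half[OF z] b by (intro powr_mono2) (auto simp: a_def c_def)
  also have "\<dots> = exp (b * a) * cos c powr b"
    using c by (simp add: powr_mult exp_powr_real mult.commute)
  also have "\<dots> \<le> exp (b * a) * cos (b * c)"
    using cos_powr_le[OF b c(1)] by simp
  also have "\<dots> = Re (exp (of_real b * L z))" by (simp add: Re_exp a_def c_def)
  finally show ?thesis .
qed

section \<open>Difference quotients of completely convex mappings\<close>

text \<open>The value at \<open>x\<close> removes the singularity. The base point precedes the
  variable, so \<open>diff_quot f x\<close> is the function \<open>G\<close> of the
  overview.\<close>

definition diff_quot :: "(complex \<Rightarrow> complex) \<Rightarrow> complex \<Rightarrow> complex \<Rightarrow> complex" where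
  "diff_quot f x z = (if z = x then deriv f x else (f z - f x) / (z - x))"

lemma
  assumes f: "f \<in> CC \<alpha>" and x: "cmod x < 1"
  shows diff_quot_holomorphic: "diff_quot f x holomorphic_on ball 0 1"
    and diff_quot_nonzero: "cmod z < 1 \<Longrightarrow> diff_quot f x z \<noteq> 0"
    and CC_log_deriv_ge: "cmod z < 1 \<Longrightarrow>
      Re (1 + 2 * z * (deriv (diff_quot f x) z / diff_quot f x z)) \<ge> \<alpha>"
proof -
  let ?G = "diff_quot f x"
  have hol: "f holomorphic_on ball 0 1" and inj: "inj_on f (ball 0 1)"
    and cc: "\<And>z. cmod z < 1 \<Longrightarrow> Re (cc_expr f z x) \<ge> \<alpha>"
    using f x by (auto simp: CC_def)
  show G: "?G holomorphic_on ball 0 1"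
    unfolding diff_quot_def by (rule pole_lemma_open[OF hol open_ball])
  show nz: "?G z \<noteq> 0" if "cmod z < 1" for z
  proof (cases "z = x")
    case True
    then show ?thesis
      using holomorphic_injective_imp_regular[OF hol open_ball inj, of x] x
      by (simp add: diff_quot_def)
  next
    case False
    then show ?thesis using inj_onD[OF inj, of z x] that x by (auto simp: diff_quot_def)
  qed
  let ?Q = "\<lambda>z. 1 + 2 * z * (deriv ?G z / ?G z)"
  have eq: "?Q z = cc_expr f z x" if z: "cmod z < 1" "z \<noteq> x" for z
  proof -
    have ne: "f z - f x \<noteq> 0" using inj_onD[OF inj, of z x] z x by auto
    have zx: "z - x \<noteq> 0" using z by simp
    have "(f has_field_derivative deriv f z) (at z)"
      using z by (intro holomorphic_derivI[OF hol]) auto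
    then have "((\<lambda>z. (f z - f x) / (z - x)) has_field_derivative
        (deriv f z * (z - x) - (f z - f x)) / ((z - x) * (z - x))) (at z)"
      using zx by (auto intro!: derivative_eq_intros)
    then have "(?G has_field_derivative
        (deriv f z * (z - x) - (f z - f x)) / ((z - x) * (z - x))) (at z)"
    proof (rule has_field_derivative_transform_within_open[where S = "- {x}"])
    qed (use z in \<open>auto simp: diff_quot_def\<close>)
    then have "deriv ?G z = (deriv f z * (z - x) - (f z - f x)) / ((z - x) * (z - x))"
      by (rule DERIV_imp_deriv)
    then have "deriv ?G z / ?G z = deriv f z / (f z - f x) - 1 / (z - x)"
      using ne zx by (simp add: diff_quot_def divide_simps)
    then have "?Q z = 1 + 2 * z * (deriv f z / (f z - f x) - 1 / (z - x))"
      by (simp only:)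
    also have "\<dots> = 2 * z * deriv f z / (f z - f x) + (1 - 2 * z / (z - x))"
      by (simp add: algebra_simps)
    also have "1 - 2 * z / (z - x) = - ((z + x) / (z - x))"
      using zx by (simp add: divide_simps)
    finally show ?thesis using z by (simp add: cc_expr_def)
  qed
  show "Re (?Q z) \<ge> \<alpha>" if z: "cmod z < 1" for z
  proof (cases "z = x")
    case False
    then show ?thesis using eq cc z by simp
  next
    case True
    \<comment> \<open>The bound already shown for \<open>z \<noteq> x\<close> passes to
      \<open>x\<close> in the limit, by continuity of \<open>?Q\<close>.\<close>
    have "?Q holomorphic_on ball 0 1"
      using nz by (intro holomorphic_intros holomorphic_deriv G) auto
    then have "continuous_on (ball 0 1) ?Q" by (rule holomorphic_on_imp_continuous_on)
    then have "isCont ?Q x" using x by (simp add: continuous_on_eq_continuous_at)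
    then have lim: "((\<lambda>z. Re (?Q z)) \<longlongrightarrow> Re (?Q x)) (at x)"
      by (intro tendsto_Re) (simp add: isCont_def)
    have "eventually (\<lambda>z. z \<in> ball 0 1 - {x}) (at x)"
      using x by (intro eventually_at_in_open) auto
    then have "eventually (\<lambda>z. \<alpha> \<le> Re (?Q z)) (at x)"
      by (rule eventually_mono) (use eq cc in auto)
    then show ?thesis using tendsto_lowerbound[OF lim] True by simp
  qed
qed

text \<open>Subtracting \<open>\<alpha>\<close> and dividing by \<open>1 - \<alpha>\<close> gives
  \<open>C\<close> with \<open>C 0 = 1\<close> and nonnegative real part. Strict positivity of
  \<open>Re (C z)\<close> yields the first claim, the bound on \<open>deriv C 0\<close> the
  second.\<close>

lemma
  fixes \<alpha> :: real
  assumes \<alpha>: "\<alpha> < 1" and f: "f \<in> CC \<alpha>" and x: "cmod x < 1"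
  shows CC_log_deriv_gt: "cmod z < 1 \<Longrightarrow>
      Re (z * (deriv (diff_quot f x) z / diff_quot f x z)) > - (1 - \<alpha>) / 2"
    and CC_log_deriv_0_le: "cmod (deriv (diff_quot f x) 0 / diff_quot f x 0) \<le> 1 - \<alpha>"
proof -
  let ?H = "\<lambda>z. deriv (diff_quot f x) z / diff_quot f x z"
  define C where "C = (\<lambda>z. (1 + 2 * z * ?H z - of_real \<alpha>) / of_real (1 - \<alpha>))"
  have ne: "1 - complex_of_real \<alpha> \<noteq> 0" using \<alpha> by (simp add: complex_eq_iff)
  have H: "?H holomorphic_on ball 0 1"
    using diff_quot_nonzero[OF f x]
    by (intro holomorphic_intros holomorphic_deriv diff_quot_holomorphic[OF f x]) auto
  have hol: "C holomorphic_on ball 0 1"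
    unfolding C_def using ne by (intro holomorphic_intros H) auto
  have C0: "C 0 = 1" using ne by (simp add: C_def)
  have Re_C: "Re (C z) = (Re (1 + 2 * z * ?H z) - \<alpha>) / (1 - \<alpha>)" for z
    unfolding C_def Re_divide_of_real by simp
  have Re: "Re (C z) \<ge> 0" if "cmod z < 1" for z
    using CC_log_deriv_ge[OF f x that] \<alpha> unfolding Re_C by (intro divide_nonneg_pos) auto
  show "Re (z * ?H z) > - (1 - \<alpha>) / 2" if "cmod z < 1"
  proof -
    have "Re (1 + 2 * z * ?H z) - \<alpha> > 0"
      using Caratheodory_bounds(1)[OF hol C0 Re that] \<alpha> unfolding Re_C
      by (simp add: zero_less_divide_iff)
    moreover have "Re (1 + 2 * z * ?H z) = 1 + 2 * Re (z * ?H z)"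
    proof -
      have "Re (1 + 2 * w) = 1 + 2 * Re w" for w by simp
      then show ?thesis by (simp only: mult.assoc)
    qed
    ultimately show ?thesis by simp
  qed
  have "(?H has_field_derivative deriv ?H 0) (at 0)"
    by (intro holomorphic_derivI[OF H]) auto
  \<comment> \<open>At 0 the factor \<open>z\<close> kills the term with the derivative of
    \<open>H\<close>, so \<open>d\<close> is absent from the result.\<close>
  moreover have "((\<lambda>z. (1 + 2 * z * H z - a) / c) has_field_derivative 2 * H 0 / c) (at 0)"
    if "(H has_field_derivative d) (at 0)" for H :: "complex \<Rightarrow> complex" and a c d
    unfolding divide_inverse using that by (auto intro!: derivative_eq_intros)
  ultimately have "(C has_field_derivative 2 * ?H 0 / of_real (1 - \<alpha>)) (at 0)"
    unfolding C_def by blast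
  then have "deriv C 0 = 2 * ?H 0 / of_real (1 - \<alpha>)" by (rule DERIV_imp_deriv)
  then have "2 * cmod (?H 0) / (1 - \<alpha>) \<le> 2"
    using Caratheodory_bounds(2)[OF hol C0 Re] \<alpha>
    by (simp only: norm_divide norm_mult norm_of_real norm_numeral) simp
  then show "cmod (?H 0) \<le> 1 - \<alpha>" using \<alpha> by (simp add: field_simps)
qed

text \<open>Since \<open>f 0 = 0\<close> and \<open>deriv f 0 = 1\<close>, the logarithmic
  derivative of \<open>diff_quot f x\<close> at 0 is \<open>(1 - x / f x) / x\<close>.\<close>

lemma CC_norm_diff_le:
  assumes \<alpha>: "\<alpha> < 1" and f: "f \<in> CC \<alpha>" and x: "cmod x < 1" "x \<noteq> 0"
  shows "cmod (1 - x / f x) \<le> (1 - \<alpha>) * cmod x"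
proof -
  have hol: "f holomorphic_on ball 0 1" and inj: "inj_on f (ball 0 1)"
    and f0: "f 0 = 0" "deriv f 0 = 1"
    using f by (auto simp: CC_def)
  have ne: "f x \<noteq> 0" using inj_onD[OF inj, of x 0] x f0 by auto
  have "(f has_field_derivative 1) (at 0)"
    using holomorphic_derivI[OF hol, of 0] f0 by auto
  then have "((\<lambda>z. (f z - f x) / (z - x)) has_field_derivative (f x - x) / (x * x)) (at 0)"
    using x f0 by (auto intro!: derivative_eq_intros)
  then have "(diff_quot f x has_field_derivative (f x - x) / (x * x)) (at 0)"
  proof (rule has_field_derivative_transform_within_open[where S = "- {x}"])
  qed (use x in \<open>auto simp: diff_quot_def\<close>)
  then have "deriv (diff_quot f x) 0 = (f x - x) / (x * x)" by (rule DERIV_imp_deriv)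
  then have "deriv (diff_quot f x) 0 / diff_quot f x 0 = (1 - x / f x) / x"
    using x ne f0 by (simp add: diff_quot_def field_simps)
  then show ?thesis
    using CC_log_deriv_0_le[OF \<alpha> f x(1)] x by (simp only: norm_divide) (simp add: field_simps)
qed

section \<open>The logarithm of \<open>f z / z\<close> and the final estimate\<close>

lemma quot_id_eq_diff_quot:
  assumes "f \<in> CC \<alpha>"
  shows "quot_id f z = diff_quot f 0 z"
  using assms by (simp add: CC_def quot_id_def diff_quot_def)

text \<open>A zero-free holomorphic function on the disc has a logarithm \<open>g\<close>. Dividing
  by \<open>1 - \<alpha>\<close> turns the bound \<open>- (1 - \<alpha>) / 2\<close> of
  \<open>CC_log_deriv_gt\<close> into the \<open>- 1 / 2\<close> of
  \<open>norm_one_minus_exp_le\<close>.\<close>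

lemma CC_obtain_log:
  assumes \<alpha>: "\<alpha> < 1" and f: "f \<in> CC \<alpha>"
  obtains L where "L holomorphic_on ball 0 1" "L 0 = 0"
    "\<And>z. cmod z < 1 \<Longrightarrow> quot_id f z = exp (of_real (1 - \<alpha>) * L z)"
    "\<And>z. cmod z < 1 \<Longrightarrow> cmod (1 - exp (- L z)) \<le> cmod z"
proof -
  define u where "u = diff_quot f 0"
  note u_hol = diff_quot_holomorphic[OF f, of 0, folded u_def, simplified]
  note u_nz = diff_quot_nonzero[OF f, of 0, folded u_def, simplified]
  have ne: "1 - complex_of_real \<alpha> \<noteq> 0" using \<alpha> by (simp add: complex_eq_iff)
  obtain g where g: "g holomorphic_on ball 0 1" "\<And>z. z \<in> ball 0 1 \<Longrightarrow> u z = exp (g z)"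
    using contractible_imp_holomorphic_log[OF u_hol] u_nz convex_imp_contractible[OF convex_ball]
    by (metis mem_ball_0)
  define L where "L = (\<lambda>z. (g z - g 0) / of_real (1 - \<alpha>))"
  have eL: "u z = exp (of_real (1 - \<alpha>) * L z)" if "cmod z < 1" for z
  proof -
    have "exp (g 0) = 1" using g(2)[of 0] f by (simp add: u_def diff_quot_def CC_def)
    then show ?thesis using g(2)[of z] that ne by (simp add: L_def exp_diff)
  qed
  have L: "L holomorphic_on ball 0 1" "L 0 = 0"
    unfolding L_def using ne by (auto intro!: holomorphic_intros g)
  have "Re (z * deriv L z) > - 1 / 2" if z: "cmod z < 1" for z
  proof -
    have "(L has_field_derivative deriv L z) (at z)"
      using z by (intro holomorphic_derivI[OF L(1)]) auto
    then have "((\<lambda>z. exp (of_real (1 - \<alpha>) * L z)) has_field_derivative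
        of_real (1 - \<alpha>) * deriv L z * u z) (at z)"
      using eL[OF z] by (auto intro!: derivative_eq_intros)
    then have "(u has_field_derivative of_real (1 - \<alpha>) * deriv L z * u z) (at z)"
    proof (rule has_field_derivative_transform_within_open[where S = "ball 0 1"])
    qed (use z eL in auto)
    then have "deriv u z / u z = of_real (1 - \<alpha>) * deriv L z"
      using u_nz[OF z] by (simp add: DERIV_imp_deriv)
    then have "z * (deriv u z / u z) = of_real (1 - \<alpha>) * (z * deriv L z)" by simp
    then have "Re (z * (deriv u z / u z)) = (1 - \<alpha>) * Re (z * deriv L z)"
      by (simp only: times_complex.sel Re_complex_of_real Im_complex_of_real)
    moreover have "- (1 - \<alpha>) / 2 < Re (z * (deriv u z / u z))"
      by (rule CC_log_deriv_gt[OF \<alpha> f, of 0 z, folded u_def]) (use z in auto)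
    ultimately have "(1 - \<alpha>) * (- 1 / 2) < (1 - \<alpha>) * Re (z * deriv L z)"
      by linarith
    then show ?thesis using \<alpha> by (subst (asm) mult_less_cancel_left_pos) auto
  qed
  from norm_one_minus_exp_le[OF L this] show ?thesis
    using that[OF L] eL quot_id_eq_diff_quot[OF f] by (simp add: u_def)
qed

theorem theorem2p6:
  fixes \<alpha> :: real and f :: "complex \<Rightarrow> complex"
  assumes "0 \<le> \<alpha>" and "\<alpha> < 1"
    and "f \<in> CC \<alpha>"
  shows "\<forall>z\<in>ball 0 1. Re (quot_id f z) \<ge> m_bound \<alpha> (cmod z)"
proof
  fix z :: complex assume "z \<in> ball 0 1"
  then have z: "cmod z < 1" by simp
  define b where "b = 1 - \<alpha>"
  define u where "u = quot_id f z"
  have b: "0 \<le> b" "b \<le> 1" using assms by (auto simp: b_def)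
  obtain L where L: "L holomorphic_on ball 0 1" "L 0 = 0"
    and eL: "\<And>z. cmod z < 1 \<Longrightarrow> quot_id f z = exp (of_real b * L z)"
    and le: "\<And>z. cmod z < 1 \<Longrightarrow> cmod (1 - exp (- L z)) \<le> cmod z"
    using CC_obtain_log[OF assms(2,3)] by (auto simp: b_def)
  have uL: "u = exp (of_real b * L z)" using eL[OF z] by (simp add: u_def)
  have "(1 / 2) powr b \<le> Re u"
    unfolding uL using le by (intro Re_exp_mult_ge L z b holomorphic_on_imp_continuous_on) fastforce+
  moreover have "p_bound \<alpha> (cmod z) \<le> Re u"
  proof -
    \<comment> \<open>Since \<open>cmod u = exp (b * Re (L z))\<close>, the power
      \<open>2 * b\<close> of this bound, inverted, bounds \<open>(cmod u)\<^sup>2\<close> from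
      below.\<close>
    have "cmod (exp (- L z)) \<le> 1 + cmod z"
      using le[OF z] norm_triangle_ineq4[of 1 "1 - exp (- L z)"] by simp
    then have "exp (- Re (L z)) powr (2 * b) \<le> (1 + cmod z) powr (2 * b)"
      using b by (intro powr_mono2) auto
    then have "1 / (1 + cmod z) powr (2 * b) \<le> 1 / exp (- Re (L z)) powr (2 * b)"
      by (intro divide_left_mono) (auto simp: add_nonneg_eq_0_iff)
    also have "\<dots> = (cmod u)\<^sup>2"
    proof -
      have "1 / exp (- Re (L z)) powr (2 * b) = exp (2 * (b * Re (L z)))"
        by (simp only: exp_powr_real) (simp add: exp_minus field_simps)
      then show ?thesis by (simp add: uL exp_double)
    qed
    finally have lower: "1 / (1 + cmod z) powr (2 * b) \<le> (cmod u)\<^sup>2" .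
    have u0: "u \<noteq> 0" by (simp add: uL)
    \<comment> \<open>For \<open>z \<noteq> 0\<close> the quotient \<open>1 / u\<close> is
      \<open>z / f z\<close>; for \<open>z = 0\<close> both sides vanish, as
      \<open>u = 1\<close>.\<close>
    have "cmod (1 - 1 / u) \<le> b * cmod z"
      using CC_norm_diff_le[OF assms(2,3) z] by (auto simp: u_def quot_id_def b_def)
    then have upper: "(cmod (1 - 1 / u))\<^sup>2 \<le> b\<^sup>2 * (cmod z)\<^sup>2"
      using power_mono[of _ _ 2] by (fastforce simp: power_mult_distrib)
    \<comment> \<open>The factor \<open>1 - b\<^sup>2 * (cmod z)\<^sup>2\<close> must be nonnegative
      for \<open>lower\<close> and \<open>upper\<close> to be multiplied.\<close>
    have "b * cmod z \<le> 1" using b z by (intro mult_le_one) auto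
    then have "b\<^sup>2 * (cmod z)\<^sup>2 \<le> 1"
      using power_le_one[of "b * cmod z" 2] b by (simp add: power_mult_distrib)
    with lower upper have "1 / (1 + cmod z) powr (2 * b) * (1 - b\<^sup>2 * (cmod z)\<^sup>2)
        \<le> (cmod u)\<^sup>2 * (1 - (cmod (1 - 1 / u))\<^sup>2)"
      by (intro mult_mono) auto
    also have "\<dots> = (cmod u)\<^sup>2 - (cmod (u * (1 - 1 / u)))\<^sup>2"
    proof -
      have "(cmod u)\<^sup>2 * (1 - (cmod w)\<^sup>2) = (cmod u)\<^sup>2 - (cmod (u * w))\<^sup>2" for w
        by (simp add: norm_mult power_mult_distrib algebra_simps)
      then show ?thesis .
    qed
    also have "u * (1 - 1 / u) = u - 1" using u0 by (simp add: algebra_simps)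
    also have "(cmod u)\<^sup>2 - (cmod (u - 1))\<^sup>2 = 2 * Re u - 1"
      unfolding cmod_power2 by (simp add: power2_eq_square algebra_simps)
    finally show ?thesis by (simp add: p_bound_def b_def)
  qed
  ultimately show "m_bound \<alpha> (cmod z) \<le> Re (quot_id f z)"
    by (simp add: m_bound_def b_def u_def)
qed

end
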